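(* Let $N\ge 1$ be an integer and let $r$ be an odd integer with $1\le r\le 2N-1$ such that $r$ and $N$ are relatively prime. Let $\Lambda=\{0,r/N\}+2\mathbb Z$. Let $\phi\in L^2(\mathbb R)$ be such that $\{\phi(x-\lambda):\lambda\in\Lambda\}$ is a Riesz basis for its closed linear span. Assume that there exists a function $\tilde\phi\in L^2(\mathbb R)$ such that $\{\tilde\phi(x-\lambda):\lambda\in\Lambda\}$ is biorthogonal to $\{\phi(x-\lambda):\lambda\in\Lambda\}$. Then for every $f\in\overline{\mathrm{span}}\{\phi(x-\lambda):\lambda\in\Lambda\}$, $$f=\sum_{\lambda\in\Lambda}\langle f,\tilde\phi(\cdot-\lambda)\rangle\,\phi(\cdot-\lambda)$$ with convergence in $L^2(\mathbb R)$; and there exist constants $A,B>0$ such that for every $f\in\overline{\mathrm{span}}\{\phi(x-\lambda):\lambda\in\Lambda\}$, $$A\|f\|_2^2\le\sum_{\lambda\in\Lambda}\left|\langle f,\tilde\phi(\cdot-\lambda)\rangle\right|^2\le B\|f\|_2^2.$$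
   Context: $\langle\cdot,\cdot\rangle$ and $\|\cdot\|_2$ denote the inner product and norm of $L^2(\mathbb R)$, and $\overline{\mathrm{span}}$ is the closed linear span in $L^2(\mathbb R)$. The collections $\{\phi(x-\lambda):\lambda\in\Lambda\}$ and $\{\tilde\phi(x-\lambda):\lambda\in\Lambda\}$ are biorthogonal if $\langle\phi(\cdot-\lambda),\tilde\phi(\cdot-\sigma)\rangle=\delta_{\lambda,\sigma}$ for all $\lambda,\sigma\in\Lambda$. *)

theory Defs
  imports "HOL-Analysis.Analysis"
begin

text \<open>
  Elements of \<open>L\<^sup>2(\<real>)\<close> are represented by complex-valued functions rather than by classes
  modulo almost-everywhere equality. Accordingly \<open>l2_norm\<close> is only a seminorm on \<open>L2\<close>, and an
  identity in \<open>L\<^sup>2(\<real>)\<close> is expressed through the vanishing of the norm of a difference.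
\<close>

definition L2 :: "(real \<Rightarrow> complex) set" where
  "L2 = {f \<in> borel_measurable lebesgue. integrable lebesgue (\<lambda>x. (cmod (f x))\<^sup>2)}"

definition l2_inner :: "(real \<Rightarrow> complex) \<Rightarrow> (real \<Rightarrow> complex) \<Rightarrow> complex" where
  "l2_inner f g = (LINT x|lebesgue. f x * cnj (g x))"

definition l2_norm :: "(real \<Rightarrow> complex) \<Rightarrow> real" where
  "l2_norm f = sqrt (LINT x|lebesgue. (cmod (f x))\<^sup>2)"

definition shift :: "(real \<Rightarrow> complex) \<Rightarrow> real \<Rightarrow> real \<Rightarrow> complex" where
  "shift f l = (\<lambda>x. f (x - l))"

text \<open>The closure in \<open>L\<^sup>2(\<real>)\<close> of the set of finite linear combinations of the family \<open>g\<close>.\<close>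

definition l2_closed_span :: "'i set \<Rightarrow> ('i \<Rightarrow> real \<Rightarrow> complex) \<Rightarrow> (real \<Rightarrow> complex) set" where
  "l2_closed_span I g =
     {f \<in> L2. \<forall>e>0. \<exists>F c. finite F \<and> F \<subseteq> I \<and> l2_norm (\<lambda>x. f x - (\<Sum>i\<in>F. c i * g i x)) < e}"

text \<open>
  A Riesz basis of a closed subspace \<open>V\<close>: a family that is complete in \<open>V\<close> and whose finite linear
  combinations have norms comparable to the \<open>\<ell>\<^sup>2\<close>-norms of their coefficients.
\<close>

definition riesz_basis ::
    "'i set \<Rightarrow> ('i \<Rightarrow> real \<Rightarrow> complex) \<Rightarrow> (real \<Rightarrow> complex) set \<Rightarrow> bool" where
  "riesz_basis I g V \<longleftrightarrow>
     (\<forall>i\<in>I. g i \<in> L2) \<and>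
     l2_closed_span I g = V \<and>
     (\<exists>A>0. \<exists>B>0. \<forall>F c. finite F \<and> F \<subseteq> I \<longrightarrow>
        A * (\<Sum>i\<in>F. (cmod (c i))\<^sup>2) \<le> (l2_norm (\<lambda>x. \<Sum>i\<in>F. c i * g i x))\<^sup>2 \<and>
        (l2_norm (\<lambda>x. \<Sum>i\<in>F. c i * g i x))\<^sup>2 \<le> B * (\<Sum>i\<in>F. (cmod (c i))\<^sup>2))"

definition biorthogonal ::
    "'i set \<Rightarrow> ('i \<Rightarrow> real \<Rightarrow> complex) \<Rightarrow> ('i \<Rightarrow> real \<Rightarrow> complex) \<Rightarrow> bool" where
  "biorthogonal I g h \<longleftrightarrow> (\<forall>i\<in>I. \<forall>j\<in>I. l2_inner (g i) (h j) = (if i = j then 1 else 0))"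

text \<open>
  Convergence of \<open>\<Sum>i\<in>I. u i\<close> to \<open>f\<close> in \<open>L\<^sup>2(\<real>)\<close>, along the net of finite subsets of \<open>I\<close>
  (unconditional convergence), as for \<^const>\<open>has_sum\<close>.
\<close>

definition l2_has_sum ::
    "('i \<Rightarrow> real \<Rightarrow> complex) \<Rightarrow> (real \<Rightarrow> complex) \<Rightarrow> 'i set \<Rightarrow> bool" where
  "l2_has_sum u f I \<longleftrightarrow>
     ((\<lambda>F. l2_norm (\<lambda>x. f x - (\<Sum>i\<in>F. u i x))) \<longlongrightarrow> 0) (finite_subsets_at_top I)"

definition Lambda :: "nat \<Rightarrow> nat \<Rightarrow> real set" where
  "Lambda r N = {a + 2 * of_int k | a k. a \<in> {0, real r / real N}}"

end

theory Submission
  imports Defs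
begin

text \<open>
  The reason is the one by which a Riesz basis of a Hilbert space expands every vector. Square
  integrability of the translates, a consequence of the translation invariance of Lebesgue measure,
  brings the two families into that setting.

  Let \<open>g\<close> be a Riesz sequence with bounds \<open>A, B\<close> and \<open>h\<close> a biorthogonal family. On a finite
  combination \<open>p = (\<Sum>i\<in>G. c i * g i)\<close> the functional \<open>l2_inner p (h i)\<close> reads off the coefficient
  \<open>c i\<close>, so the lower Riesz bound says that \<open>p\<close> satisfies a Bessel inequality with constant
  \<open>1 / A\<close>. For a fixed finite index set both sides of that inequality are continuous, by
  Cauchy--Schwarz, so it passes to every \<open>f\<close> in the closed span, with a constant independent of the
  index set (\<open>bessel\<close>). This is the upper frame bound.

  Combined with the upper Riesz bound it makes the partial sum operators
  \<open>S F f = (\<Sum>i\<in>F. l2_inner f (h i) * g i)\<close> bounded by \<open>sqrt (B / A)\<close>, uniformly in the finite set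
  \<open>F\<close>. Moreover \<open>S F p = p\<close> as soon as \<open>F\<close> contains the index set of \<open>p\<close>. Hence \<open>f - S F f\<close> is
  small whenever \<open>F\<close> is large, because \<open>f - S F f = (f - p) - S F (f - p)\<close> (\<open>expansion\<close>). Finally
  the upper Riesz bound, applied to \<open>S F f\<close> and passed to the limit, is the lower frame bound.
\<close>

section \<open>The semi-inner product space of square integrable functions\<close>

lemma L2_measurable: "f \<in> L2 \<Longrightarrow> f \<in> borel_measurable lebesgue"
  by (simp add: L2_def)

lemma L2_integrable_norm_sq: "f \<in> L2 \<Longrightarrow> integrable lebesgue (\<lambda>x. (cmod (f x))\<^sup>2)"
  by (simp add: L2_def)

lemma L2_cmult: "f \<in> L2 \<Longrightarrow> (\<lambda>x. c * f x) \<in> L2"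
  by (auto simp: L2_def norm_mult power_mult_distrib)

lemma L2_add:
  assumes "f \<in> L2" "g \<in> L2"
  shows "(\<lambda>x. f x + g x) \<in> L2"
proof -
  note [measurable] = L2_measurable[OF assms(1)] L2_measurable[OF assms(2)]
  have bound: "(cmod (a + b))\<^sup>2 \<le> 2 * (cmod a)\<^sup>2 + 2 * (cmod b)\<^sup>2" for a b
  proof -
    have "(cmod (a + b))\<^sup>2 \<le> (cmod a + cmod b)\<^sup>2"
      by (intro power_mono norm_triangle_ineq) auto
    also have "\<dots> \<le> 2 * (cmod a)\<^sup>2 + 2 * (cmod b)\<^sup>2"
      using zero_le_power2[of "cmod a - cmod b"] by (simp add: power2_eq_square algebra_simps)
    finally show ?thesis .
  qed
  have "integrable lebesgue (\<lambda>x. (cmod (f x + g x))\<^sup>2)"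
  proof (rule Bochner_Integration.integrable_bound)
    show "integrable lebesgue (\<lambda>x. 2 * (cmod (f x))\<^sup>2 + 2 * (cmod (g x))\<^sup>2)"
      using assms by (simp add: L2_integrable_norm_sq)
    show "AE x in lebesgue. norm ((cmod (f x + g x))\<^sup>2)
        \<le> norm (2 * (cmod (f x))\<^sup>2 + 2 * (cmod (g x))\<^sup>2)"
      using bound by (intro AE_I2) (simp add: abs_of_nonneg)
  qed simp
  then show ?thesis
    by (simp add: L2_def)
qed

lemma L2_diff:
  assumes "f \<in> L2" "g \<in> L2"
  shows "(\<lambda>x. f x - g x) \<in> L2"
  using L2_add[OF assms(1) L2_cmult[OF assms(2), of "-1"]] by simp

lemma L2_sum:
  assumes "\<And>i. i \<in> F \<Longrightarrow> u i \<in> L2"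
  shows "(\<lambda>x. \<Sum>i\<in>F. u i x) \<in> L2"
  using assms
proof (induction F rule: infinite_finite_induct)
  case (insert i F)
  then show ?case
    using L2_add[of "u i" "\<lambda>x. \<Sum>i\<in>F. u i x"] by simp
qed (auto simp: L2_def)

lemma L2_shift:
  assumes "f \<in> L2"
  shows "shift f l \<in> L2"
proof -
  have T: "(\<lambda>x::real. x - l) \<in> lebesgue \<rightarrow>\<^sub>M lebesgue"
    using lebesgue_affine_measurable[of "\<lambda>_::real. 1" "- l"] by simp
  have "shift f l \<in> borel_measurable lebesgue"
    unfolding shift_def using measurable_compose[OF T L2_measurable[OF assms]] .
  moreover have "integrable lebesgue (\<lambda>x. (cmod (shift f l x))\<^sup>2)"
    using lebesgue_integrable_real_affine[OF L2_integrable_norm_sq[OF assms], of 1 "- l"]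
    by (simp add: shift_def)
  ultimately show ?thesis
    by (simp add: L2_def)
qed

lemma integrable_L2_inner:
  assumes "f \<in> L2" "g \<in> L2"
  shows "integrable lebesgue (\<lambda>x. f x * cnj (g x))"
proof (rule Bochner_Integration.integrable_bound)
  note [measurable] = L2_measurable[OF assms(1)] L2_measurable[OF assms(2)]
  show "integrable lebesgue (\<lambda>x. (cmod (f x))\<^sup>2 + (cmod (g x))\<^sup>2)"
    using assms by (simp add: L2_integrable_norm_sq)
  show "(\<lambda>x. f x * cnj (g x)) \<in> borel_measurable lebesgue"
    using borel_measurable_continuous_onI[of cnj] by measurable
  have "a * b \<le> a\<^sup>2 + b\<^sup>2" if "a \<ge> 0" "b \<ge> 0" for a b :: real
    using sum_squares_bound[of a b] mult_nonneg_nonneg[OF that] by linarith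
  then show "AE x in lebesgue. norm (f x * cnj (g x)) \<le> norm ((cmod (f x))\<^sup>2 + (cmod (g x))\<^sup>2)"
    by (auto simp: norm_mult)
qed

lemma l2_norm_nonneg [simp]: "0 \<le> l2_norm f"
  by (simp add: l2_norm_def)

lemma l2_norm_sq: "(l2_norm f)\<^sup>2 = (LINT x|lebesgue. (cmod (f x))\<^sup>2)"
  by (simp add: l2_norm_def)

lemma l2_norm_uminus: "l2_norm (\<lambda>x. - f x) = l2_norm f"
  by (simp add: l2_norm_def)

lemma l2_inner_diff_left:
  assumes "f \<in> L2" "g \<in> L2" "h \<in> L2"
  shows "l2_inner (\<lambda>x. f x - g x) h = l2_inner f h - l2_inner g h"
  using assms by (simp add: l2_inner_def left_diff_distrib integrable_L2_inner)

lemma l2_inner_sum_left: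
  assumes "\<And>i. i \<in> F \<Longrightarrow> u i \<in> L2" "h \<in> L2"
  shows "l2_inner (\<lambda>x. \<Sum>i\<in>F. c i * u i x) h = (\<Sum>i\<in>F. c i * l2_inner (u i) h)"
  using assms
  by (simp add: l2_inner_def sum_distrib_right mult.assoc integrable_L2_inner)

text \<open>
  Integrating the pointwise inequality \<open>2 * \<bar>f\<bar> * \<bar>g\<bar> \<le> t * \<bar>f\<bar>\<^sup>2 + \<bar>g\<bar>\<^sup>2 / t\<close> gives a bound for every
  \<open>t > 0\<close>; the optimal \<open>t\<close> is \<open>l2_norm g / l2_norm f\<close>. As either norm may vanish, both are first
  enlarged by \<open>e > 0\<close>, which is then sent to \<open>0\<close>.
\<close>

lemma l2_Cauchy_Schwarz:
  assumes "f \<in> L2" "g \<in> L2"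
  shows "cmod (l2_inner f g) \<le> l2_norm f * l2_norm g"
proof -
  have weighted: "2 * cmod (l2_inner f g) \<le> t * (l2_norm f)\<^sup>2 + (l2_norm g)\<^sup>2 / t" if "t > 0" for t
  proof -
    have pointwise: "2 * cmod (a * cnj b) \<le> t * (cmod a)\<^sup>2 + (cmod b)\<^sup>2 / t" for a b
    proof -
      have "0 \<le> (t * cmod a - cmod b)\<^sup>2 / t"
        using that by simp
      also have "\<dots> = t * (cmod a)\<^sup>2 + (cmod b)\<^sup>2 / t - 2 * cmod (a * cnj b)"
        using that by (simp add: norm_mult power2_eq_square field_simps)
      finally show ?thesis
        by simp
    qed
    have "2 * cmod (l2_inner f g) \<le> 2 * (LINT x|lebesgue. cmod (f x * cnj (g x)))"
      unfolding l2_inner_def by simp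
    also have "\<dots> = (LINT x|lebesgue. 2 * cmod (f x * cnj (g x)))"
      by simp
    also have "\<dots> \<le> (LINT x|lebesgue. t * (cmod (f x))\<^sup>2 + (cmod (g x))\<^sup>2 / t)"
    proof (rule integral_mono)
      show "integrable lebesgue (\<lambda>x. 2 * cmod (f x * cnj (g x)))"
        using integrable_L2_inner[OF assms] by (intro integrable_mult_right integrable_norm)
      show "integrable lebesgue (\<lambda>x. t * (cmod (f x))\<^sup>2 + (cmod (g x))\<^sup>2 / t)"
        using assms by (simp add: L2_integrable_norm_sq)
    qed (rule pointwise)
    also have "\<dots> = t * (l2_norm f)\<^sup>2 + (l2_norm g)\<^sup>2 / t"
      using assms by (simp add: L2_integrable_norm_sq l2_norm_sq)
    finally show ?thesis .
  qed
  have perturbed: "cmod (l2_inner f g) \<le> (l2_norm f + e) * (l2_norm g + e)" if "e > 0" for e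
  proof -
    define a b where "a = l2_norm f + e" and "b = l2_norm g + e"
    have pos: "a > 0" "b > 0" and le: "l2_norm f \<le> a" "l2_norm g \<le> b"
      using that by (auto simp: a_def b_def add_nonneg_pos)
    have "2 * cmod (l2_inner f g) \<le> (b / a) * (l2_norm f)\<^sup>2 + (l2_norm g)\<^sup>2 / (b / a)"
      using pos by (intro weighted) simp
    also have "\<dots> \<le> (b / a) * a\<^sup>2 + b\<^sup>2 / (b / a)"
      using pos le by (intro add_mono mult_left_mono divide_right_mono power_mono) auto
    also have "\<dots> = 2 * (a * b)"
      using pos by (simp add: power2_eq_square)
    finally show ?thesis
      by (simp add: a_def b_def)
  qed
  have "((\<lambda>e. (l2_norm f + e) * (l2_norm g + e)) \<longlongrightarrow> (l2_norm f + 0) * (l2_norm g + 0)) (at_right 0)"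
    by (intro tendsto_intros)
  moreover have "eventually (\<lambda>e. cmod (l2_inner f g) \<le> (l2_norm f + e) * (l2_norm g + e)) (at_right 0)"
    using perturbed by (auto simp: eventually_at_right_field intro: exI[of _ 1])
  ultimately show ?thesis
    using tendsto_lowerbound by force
qed

lemma l2_norm_triangle:
  assumes "f \<in> L2" "g \<in> L2"
  shows "l2_norm (\<lambda>x. f x + g x) \<le> l2_norm f + l2_norm g"
proof (rule power2_le_imp_le)
  have "(cmod (a + b))\<^sup>2 = (cmod a)\<^sup>2 + 2 * Re (a * cnj b) + (cmod b)\<^sup>2" for a b
    by (simp only: cmod_power2) (simp add: power2_eq_square algebra_simps)
  then have "(l2_norm (\<lambda>x. f x + g x))\<^sup>2 =
      (LINT x|lebesgue. (cmod (f x))\<^sup>2 + 2 * Re (f x * cnj (g x)) + (cmod (g x))\<^sup>2)"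
    by (simp add: l2_norm_sq)
  also have "\<dots> = (l2_norm f)\<^sup>2 + 2 * Re (l2_inner f g) + (l2_norm g)\<^sup>2"
    using assms integrable_L2_inner[OF assms]
    by (simp add: L2_integrable_norm_sq l2_norm_sq l2_inner_def del: times_complex.sel)
  also have "\<dots> \<le> (l2_norm f)\<^sup>2 + 2 * (l2_norm f * l2_norm g) + (l2_norm g)\<^sup>2"
    using l2_Cauchy_Schwarz[OF assms] complex_Re_le_cmod[of "l2_inner f g"] by simp
  also have "\<dots> = (l2_norm f + l2_norm g)\<^sup>2"
    by (simp add: power2_eq_square algebra_simps)
  finally show "(l2_norm (\<lambda>x. f x + g x))\<^sup>2 \<le> (l2_norm f + l2_norm g)\<^sup>2" .
qed simp

lemma l2_norm_triangle_diff:
  assumes "f \<in> L2" "g \<in> L2"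
  shows "l2_norm f \<le> l2_norm g + l2_norm (\<lambda>x. f x - g x)"
  using l2_norm_triangle[OF assms(2) L2_diff[OF assms]] by simp

section \<open>Closed spans\<close>

lemma closed_span_subset_L2: "f \<in> l2_closed_span I g \<Longrightarrow> f \<in> L2"
  by (simp add: l2_closed_span_def)

lemma closed_span_approx:
  assumes "f \<in> l2_closed_span I g" "e > 0"
  obtains G c where "finite G" "G \<subseteq> I" "l2_norm (\<lambda>x. f x - (\<Sum>i\<in>G. c i * g i x)) < e"
  using assms unfolding l2_closed_span_def by blast

lemma closed_span_diff_combination:
  assumes g: "\<And>i. i \<in> I \<Longrightarrow> g i \<in> L2"
    and f: "f \<in> l2_closed_span I g" and G: "finite G" "G \<subseteq> I"
  shows "(\<lambda>x. f x - (\<Sum>i\<in>G. c i * g i x)) \<in> l2_closed_span I g"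
  unfolding l2_closed_span_def
proof (intro CollectI conjI allI impI)
  show "(\<lambda>x. f x - (\<Sum>i\<in>G. c i * g i x)) \<in> L2"
    using g G closed_span_subset_L2[OF f] by (intro L2_diff L2_sum L2_cmult) auto
  fix e :: real
  assume "e > 0"
  then obtain H d where H: "finite H" "H \<subseteq> I" "l2_norm (\<lambda>x. f x - (\<Sum>i\<in>H. d i * g i x)) < e"
    using closed_span_approx[OF f] by blast
  let ?d = "\<lambda>i. (if i \<in> H then d i else 0) - (if i \<in> G then c i else 0)"
  have "(\<Sum>i\<in>H \<union> G. ?d i * g i x) = (\<Sum>i\<in>H. d i * g i x) - (\<Sum>i\<in>G. c i * g i x)" for x
  proof -
    have "(\<Sum>i\<in>H \<union> G. (if i \<in> H then d i else 0) * g i x) = (\<Sum>i\<in>H. d i * g i x)"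
      by (rule sum.mono_neutral_cong_right) (use G H in auto)
    moreover have "(\<Sum>i\<in>H \<union> G. (if i \<in> G then c i else 0) * g i x) = (\<Sum>i\<in>G. c i * g i x)"
      by (rule sum.mono_neutral_cong_right) (use G H in auto)
    ultimately show ?thesis
      by (simp only: left_diff_distrib sum_subtractf)
  qed
  then have "l2_norm (\<lambda>x. f x - (\<Sum>i\<in>G. c i * g i x) - (\<Sum>i\<in>H \<union> G. ?d i * g i x)) < e"
    using H by simp
  then show "\<exists>F c'. finite F \<and> F \<subseteq> I \<and>
      l2_norm (\<lambda>x. f x - (\<Sum>i\<in>G. c i * g i x) - (\<Sum>i\<in>F. c' i * g i x)) < e"
    using G H by (intro exI[of _ "H \<union> G"] exI[of _ ?d]) auto
qed

section \<open>Riesz sequences with a biorthogonal family\<close>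

locale biorthogonal_riesz_sequence =
  fixes I :: "'i set" and g h :: "'i \<Rightarrow> real \<Rightarrow> complex" and A B :: real
  assumes g_L2: "i \<in> I \<Longrightarrow> g i \<in> L2"
    and h_L2: "i \<in> I \<Longrightarrow> h i \<in> L2"
    and A_pos: "A > 0" and B_pos: "B > 0"
    and lower_riesz: "finite F \<Longrightarrow> F \<subseteq> I \<Longrightarrow>
      A * (\<Sum>i\<in>F. (cmod (c i))\<^sup>2) \<le> (l2_norm (\<lambda>x. \<Sum>i\<in>F. c i * g i x))\<^sup>2"
    and upper_riesz: "finite F \<Longrightarrow> F \<subseteq> I \<Longrightarrow>
      (l2_norm (\<lambda>x. \<Sum>i\<in>F. c i * g i x))\<^sup>2 \<le> B * (\<Sum>i\<in>F. (cmod (c i))\<^sup>2)"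
    and biorth: "biorthogonal I g h"
begin

lemma combination_L2: "G \<subseteq> I \<Longrightarrow> (\<lambda>x. \<Sum>i\<in>G. c i * g i x) \<in> L2"
  using g_L2 by (intro L2_sum L2_cmult) auto

lemma inner_combination:
  assumes "finite G" "G \<subseteq> I" "j \<in> I"
  shows "l2_inner (\<lambda>x. \<Sum>i\<in>G. c i * g i x) (h j) = (if j \<in> G then c j else 0)"
proof -
  have "l2_inner (\<lambda>x. \<Sum>i\<in>G. c i * g i x) (h j) = (\<Sum>i\<in>G. c i * l2_inner (g i) (h j))"
    using assms g_L2 h_L2 by (intro l2_inner_sum_left) auto
  also have "\<dots> = (\<Sum>i\<in>G. if i = j then c i else 0)"
    using assms biorth by (intro sum.cong) (auto simp: biorthogonal_def)
  finally show ?thesis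
    using assms by (simp add: sum.delta')
qed

lemma bessel_combination:
  fixes c :: "'i \<Rightarrow> complex"
  assumes "finite G" "G \<subseteq> I" "finite F" "F \<subseteq> I"
  defines "p \<equiv> \<lambda>x. \<Sum>i\<in>G. c i * g i x"
  shows "L2_set (\<lambda>i. cmod (l2_inner p (h i))) F \<le> l2_norm p / sqrt A"
proof -
  have "(\<Sum>i\<in>F. (cmod (l2_inner p (h i)))\<^sup>2) = (\<Sum>i\<in>F. if i \<in> G then (cmod (c i))\<^sup>2 else 0)"
    using assms by (intro sum.cong) (auto simp: inner_combination)
  also have "\<dots> = (\<Sum>i\<in>F \<inter> G. (cmod (c i))\<^sup>2)"
    using assms by (simp add: sum.If_cases)
  also have "\<dots> \<le> (\<Sum>i\<in>G. (cmod (c i))\<^sup>2)"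
    using assms by (intro sum_mono2) auto
  also have "\<dots> \<le> (l2_norm p)\<^sup>2 / A"
    using lower_riesz[of G c] assms A_pos by (simp add: field_simps)
  finally show ?thesis
    unfolding L2_set_def using real_sqrt_le_mono by (fastforce simp: real_sqrt_divide)
qed

text \<open>
  Each functional \<open>l2_inner _ (h i)\<close> is continuous with constant \<open>l2_norm (h i)\<close>. These constants
  bound the error made by replacing \<open>f\<close> by a finite combination only for a fixed \<open>F\<close>, but they
  disappear in the limit of better approximations, so the resulting bound is uniform in \<open>F\<close>.
\<close>

lemma bessel:
  assumes f: "f \<in> l2_closed_span I g" and F: "finite F" "F \<subseteq> I"
  shows "L2_set (\<lambda>i. cmod (l2_inner f (h i))) F \<le> l2_norm f / sqrt A"
proof -
  define K where "K = 1 / sqrt A + L2_set (\<lambda>i. l2_norm (h i)) F"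
  have approx: "L2_set (\<lambda>i. cmod (l2_inner f (h i))) F \<le> l2_norm f / sqrt A + e * K" if "e > 0" for e
  proof -
    obtain G c where G: "finite G" "G \<subseteq> I" "l2_norm (\<lambda>x. f x - (\<Sum>i\<in>G. c i * g i x)) < e"
      using closed_span_approx[OF f \<open>e > 0\<close>] by blast
    define p where "p = (\<lambda>x. \<Sum>i\<in>G. c i * g i x)"
    define q where "q = (\<lambda>x. f x - p x)"
    have L2: "f \<in> L2" "p \<in> L2" "q \<in> L2"
      using closed_span_subset_L2[OF f] combination_L2[OF G(2)]
      by (auto simp: p_def q_def intro: L2_diff)
    have q: "l2_norm q \<le> e"
      using G by (simp add: p_def q_def)
    have p: "l2_norm p \<le> l2_norm f + e"
      using l2_norm_triangle_diff[OF L2(2,1)] q l2_norm_uminus[of q] by (simp add: q_def)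
    have "L2_set (\<lambda>i. cmod (l2_inner f (h i))) F
        \<le> L2_set (\<lambda>i. cmod (l2_inner p (h i)) + e * l2_norm (h i)) F"
    proof (rule L2_set_mono)
      fix i assume "i \<in> F"
      then have h: "h i \<in> L2"
        using F h_L2 by auto
      have "l2_inner f (h i) = l2_inner p (h i) + l2_inner q (h i)"
        using l2_inner_diff_left[OF L2(1,2) h] by (simp add: q_def)
      then have "cmod (l2_inner f (h i)) \<le> cmod (l2_inner p (h i)) + cmod (l2_inner q (h i))"
        by (simp add: norm_triangle_ineq)
      also have "cmod (l2_inner q (h i)) \<le> e * l2_norm (h i)"
        using l2_Cauchy_Schwarz[OF L2(3) h] mult_right_mono[OF q l2_norm_nonneg] by (rule order_trans)
      finally show "cmod (l2_inner f (h i)) \<le> cmod (l2_inner p (h i)) + e * l2_norm (h i)"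
        by simp
    qed simp
    also have "\<dots> \<le> L2_set (\<lambda>i. cmod (l2_inner p (h i))) F + L2_set (\<lambda>i. e * l2_norm (h i)) F"
      by (rule L2_set_triangle_ineq)
    also have "L2_set (\<lambda>i. e * l2_norm (h i)) F = e * L2_set (\<lambda>i. l2_norm (h i)) F"
      using that by (simp add: L2_set_right_distrib)
    also have "L2_set (\<lambda>i. cmod (l2_inner p (h i))) F \<le> l2_norm p / sqrt A"
      unfolding p_def using G F by (intro bessel_combination) auto
    also have "\<dots> \<le> (l2_norm f + e) / sqrt A"
      using p A_pos by (intro divide_right_mono) auto
    finally show ?thesis
      by (simp add: K_def add_divide_distrib algebra_simps)
  qed
  have "((\<lambda>e. l2_norm f / sqrt A + e * K) \<longlongrightarrow> l2_norm f / sqrt A + 0 * K) (at_right 0)"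
    by (intro tendsto_intros)
  moreover have "eventually (\<lambda>e. L2_set (\<lambda>i. cmod (l2_inner f (h i))) F
      \<le> l2_norm f / sqrt A + e * K) (at_right 0)"
    using approx by (auto simp: eventually_at_right_field intro: exI[of _ 1])
  ultimately show ?thesis
    using tendsto_lowerbound by force
qed

lemma bessel_sq:
  assumes "f \<in> l2_closed_span I g" "finite F" "F \<subseteq> I"
  shows "(\<Sum>i\<in>F. (cmod (l2_inner f (h i)))\<^sup>2) \<le> (l2_norm f)\<^sup>2 / A"
proof -
  have "(L2_set (\<lambda>i. cmod (l2_inner f (h i))) F)\<^sup>2 \<le> (l2_norm f / sqrt A)\<^sup>2"
    using bessel[OF assms] by (intro power_mono) auto
  then show ?thesis
    using A_pos by (simp add: L2_set_def sum_nonneg power_divide)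
qed

abbreviation partial_sum :: "'i set \<Rightarrow> (real \<Rightarrow> complex) \<Rightarrow> real \<Rightarrow> complex" where
  "partial_sum F f \<equiv> \<lambda>x. \<Sum>i\<in>F. l2_inner f (h i) * g i x"

lemma partial_sum_bound:
  assumes "f \<in> l2_closed_span I g" "finite F" "F \<subseteq> I"
  shows "l2_norm (partial_sum F f) \<le> sqrt (B / A) * l2_norm f"
proof (rule power2_le_imp_le)
  have "(l2_norm (partial_sum F f))\<^sup>2 \<le> B * (\<Sum>i\<in>F. (cmod (l2_inner f (h i)))\<^sup>2)"
    using assms by (intro upper_riesz)
  also have "\<dots> \<le> B * ((l2_norm f)\<^sup>2 / A)"
    using assms B_pos by (intro mult_left_mono bessel_sq) auto
  also have "\<dots> = (sqrt (B / A) * l2_norm f)\<^sup>2"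
    using A_pos B_pos by (simp add: power_mult_distrib)
  finally show "(l2_norm (partial_sum F f))\<^sup>2 \<le> (sqrt (B / A) * l2_norm f)\<^sup>2" .
qed (use A_pos B_pos in simp)

lemma partial_sum_diff_combination:
  assumes f: "f \<in> L2" and G: "finite G" "G \<subseteq> F" and F: "finite F" "F \<subseteq> I"
  shows "partial_sum F (\<lambda>y. f y - (\<Sum>i\<in>G. c i * g i y)) x
    = partial_sum F f x - (\<Sum>i\<in>G. c i * g i x)"
proof -
  have "G \<subseteq> I"
    using G F by auto
  have "partial_sum F (\<lambda>y. f y - (\<Sum>i\<in>G. c i * g i y)) x
      = (\<Sum>i\<in>F. l2_inner f (h i) * g i x - (if i \<in> G then c i else 0) * g i x)"
    using f F h_L2 G \<open>G \<subseteq> I\<close>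
    by (intro sum.cong)
      (auto simp: l2_inner_diff_left combination_L2 inner_combination subset_iff left_diff_distrib)
  also have "\<dots> = partial_sum F f x - (\<Sum>i\<in>F. (if i \<in> G then c i else 0) * g i x)"
    by (simp add: sum_subtractf)
  also have "(\<Sum>i\<in>F. (if i \<in> G then c i else 0) * g i x) = (\<Sum>i\<in>G. c i * g i x)"
    by (rule sum.mono_neutral_cong_right) (use G F in auto)
  finally show ?thesis .
qed

text \<open>
  With \<open>q = f - p\<close> for a finite combination \<open>p\<close> whose indices lie in \<open>F\<close>, the error of the partial
  sum over \<open>F\<close> is \<open>q\<close> minus the partial sum of \<open>q\<close>, hence at most \<open>1 + sqrt (B / A)\<close> times the norm
  of \<open>q\<close>.
\<close>

lemma expansion:
  assumes f: "f \<in> l2_closed_span I g"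
  shows "l2_has_sum (\<lambda>i x. l2_inner f (h i) * g i x) f I"
  unfolding l2_has_sum_def
proof (rule tendstoI)
  fix e :: real
  assume "e > 0"
  define K where "K = 1 + sqrt (B / A)"
  have K: "K > 0"
    using A_pos B_pos by (simp add: K_def add_pos_nonneg)
  obtain G c where G: "finite G" "G \<subseteq> I" "l2_norm (\<lambda>x. f x - (\<Sum>i\<in>G. c i * g i x)) < e / K"
    using closed_span_approx[OF f, of "e / K"] \<open>e > 0\<close> K by auto
  define q where "q = (\<lambda>x. f x - (\<Sum>i\<in>G. c i * g i x))"
  have q: "q \<in> l2_closed_span I g"
    unfolding q_def using g_L2 f G by (intro closed_span_diff_combination) auto
  have "l2_norm (\<lambda>x. f x - partial_sum F f x) < e" if F: "finite F" "G \<subseteq> F" "F \<subseteq> I" for F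
  proof -
    have "partial_sum F q x = partial_sum F f x - (\<Sum>i\<in>G. c i * g i x)" for x
      unfolding q_def
      using partial_sum_diff_combination[OF closed_span_subset_L2[OF f] G(1) F(2,1,3)] .
    then have "(\<lambda>x. f x - partial_sum F f x) = (\<lambda>x. q x + - partial_sum F q x)"
      by (simp add: q_def)
    then have "l2_norm (\<lambda>x. f x - partial_sum F f x) \<le> l2_norm q + l2_norm (partial_sum F q)"
      using l2_norm_triangle[OF closed_span_subset_L2[OF q]
          L2_cmult[OF combination_L2[OF F(3)], of "-1" "\<lambda>i. l2_inner q (h i)"]]
      by (simp add: l2_norm_uminus)
    also have "\<dots> \<le> K * l2_norm q"
      using partial_sum_bound[OF q F(1,3)] by (simp add: K_def distrib_right)
    also have "\<dots> < K * (e / K)"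
      using G K by (intro mult_strict_left_mono) (auto simp: q_def)
    finally show ?thesis
      using K by simp
  qed
  then show "\<forall>\<^sub>F F in finite_subsets_at_top I. dist (l2_norm (\<lambda>x. f x - partial_sum F f x)) 0 < e"
    using G by (auto simp: eventually_finite_subsets_at_top intro!: exI[of _ G])
qed

lemma coefficients_summable:
  assumes "f \<in> l2_closed_span I g"
  shows "(\<lambda>i. (cmod (l2_inner f (h i)))\<^sup>2) summable_on I"
  using bessel_sq[OF assms]
  by (intro nonneg_bdd_above_summable_on) (auto intro!: bdd_aboveI)

lemma upper_frame_bound:
  assumes "f \<in> l2_closed_span I g"
  shows "(\<Sum>\<^sub>\<infinity>i\<in>I. (cmod (l2_inner f (h i)))\<^sup>2) \<le> (1 / A) * (l2_norm f)\<^sup>2"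
  using bessel_sq[OF assms] by (intro infsum_le_finite_sums coefficients_summable[OF assms]) auto

text \<open>
  The partial sums of the expansion have norm at most \<open>sqrt (B * S)\<close>, where \<open>S\<close> is the sum of all
  squared coefficients, and their norms converge to that of \<open>f\<close>.
\<close>

lemma lower_frame_bound:
  assumes f: "f \<in> l2_closed_span I g"
  shows "(1 / B) * (l2_norm f)\<^sup>2 \<le> (\<Sum>\<^sub>\<infinity>i\<in>I. (cmod (l2_inner f (h i)))\<^sup>2)"
proof -
  define S where "S = (\<Sum>\<^sub>\<infinity>i\<in>I. (cmod (l2_inner f (h i)))\<^sup>2)"
  have S: "S \<ge> 0"
    by (simp add: S_def infsum_nonneg)
  have bound: "l2_norm f \<le> sqrt (B * S) + l2_norm (\<lambda>x. f x - partial_sum F f x)"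
    if F: "finite F" "F \<subseteq> I" for F
  proof -
    have "(l2_norm (partial_sum F f))\<^sup>2 \<le> B * (\<Sum>i\<in>F. (cmod (l2_inner f (h i)))\<^sup>2)"
      using F by (intro upper_riesz)
    also have "\<dots> \<le> B * S"
      unfolding S_def using F B_pos coefficients_summable[OF f]
      by (intro mult_left_mono finite_sum_le_infsum) auto
    finally have "l2_norm (partial_sum F f) \<le> sqrt (B * S)"
      by (rule real_le_rsqrt)
    then show ?thesis
      using l2_norm_triangle_diff[OF closed_span_subset_L2[OF f] combination_L2[OF F(2)],
          of "\<lambda>i. l2_inner f (h i)"] by linarith
  qed
  have "((\<lambda>F. sqrt (B * S) + l2_norm (\<lambda>x. f x - partial_sum F f x)) \<longlongrightarrow> sqrt (B * S) + 0)
      (finite_subsets_at_top I)"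
    using expansion[OF f] unfolding l2_has_sum_def by (intro tendsto_intros)
  moreover have "eventually (\<lambda>F. l2_norm f \<le> sqrt (B * S) + l2_norm (\<lambda>x. f x - partial_sum F f x))
      (finite_subsets_at_top I)"
    using bound by (intro eventually_finite_subsets_at_top_weakI) auto
  ultimately have "l2_norm f \<le> sqrt (B * S) + 0"
    by (rule tendsto_lowerbound) simp
  then have "(l2_norm f)\<^sup>2 \<le> (sqrt (B * S))\<^sup>2"
    by (intro power_mono) auto
  then show ?thesis
    using S B_pos by (simp add: S_def field_simps)
qed

end

section \<open>Translates of a single function\<close>

theorem theorem3p4:
  fixes N r :: nat and \<phi> \<phi>t :: "real \<Rightarrow> complex"
  assumes "N \<ge> 1" and "odd r" and "1 \<le> r" and "r \<le> 2 * N - 1" and "coprime r N"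
    and "\<phi> \<in> L2"
    and "riesz_basis (Lambda r N) (shift \<phi>) (l2_closed_span (Lambda r N) (shift \<phi>))"
    and "\<phi>t \<in> L2"
    and "biorthogonal (Lambda r N) (shift \<phi>) (shift \<phi>t)"
  shows "(\<forall>f \<in> l2_closed_span (Lambda r N) (shift \<phi>).
            l2_has_sum (\<lambda>l x. l2_inner f (shift \<phi>t l) * shift \<phi> l x) f (Lambda r N)) \<and>
         (\<exists>A>0. \<exists>B>0. \<forall>f \<in> l2_closed_span (Lambda r N) (shift \<phi>).
            (\<lambda>l. (cmod (l2_inner f (shift \<phi>t l)))\<^sup>2) summable_on Lambda r N \<and>
            A * (l2_norm f)\<^sup>2 \<le> (\<Sum>\<^sub>\<infinity>l\<in>Lambda r N. (cmod (l2_inner f (shift \<phi>t l)))\<^sup>2) \<and>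
            (\<Sum>\<^sub>\<infinity>l\<in>Lambda r N. (cmod (l2_inner f (shift \<phi>t l)))\<^sup>2) \<le> B * (l2_norm f)\<^sup>2)"
proof -
  obtain A B where AB: "A > 0" "B > 0"
    and riesz: "\<forall>F c. finite F \<and> F \<subseteq> Lambda r N \<longrightarrow>
      A * (\<Sum>l\<in>F. (cmod (c l))\<^sup>2) \<le> (l2_norm (\<lambda>x. \<Sum>l\<in>F. c l * shift \<phi> l x))\<^sup>2 \<and>
      (l2_norm (\<lambda>x. \<Sum>l\<in>F. c l * shift \<phi> l x))\<^sup>2 \<le> B * (\<Sum>l\<in>F. (cmod (c l))\<^sup>2)"
    using \<open>riesz_basis _ _ _\<close> unfolding riesz_basis_def by blast
  interpret biorthogonal_riesz_sequence "Lambda r N" "shift \<phi>" "shift \<phi>t" A B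
    using AB riesz \<open>\<phi> \<in> L2\<close> \<open>\<phi>t \<in> L2\<close> \<open>biorthogonal _ _ _\<close>
    by unfold_locales (auto intro: L2_shift)
  have "1 / B > 0" "1 / A > 0"
    using AB by auto
  then show ?thesis
    using expansion coefficients_summable lower_frame_bound upper_frame_bound by blast
qed

end
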